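(* For almost all permutations $\sigma$, there is some power of $\sigma$ that is a cycle of prime length. That is, if $p_n$ denotes the proportion of elements $\sigma\in S_n$ for which there exist an integer $m$ and a prime $p$ such that $\sigma^m$ is a $p$-cycle, then $\lim_{n\to\infty}p_n=1$.
   Context: $S_n$ is the symmetric group on $\{1,2,\dots,n\}$. The proportion of elements of $S_n$ with a property is the number of elements with that property divided by $n!$. A property holds for almost all permutations when the proportion of elements of $S_n$ having the property tends to $1$ as $n\to\infty$. A permutation is an $\ell$-cycle (a cycle of length $\ell$) if its disjoint cycle decomposition consists of exactly one cycle of length $\ell>1$ together with some number (perhaps zero) of fixed points. *)

theory Defs
  imports Complex_Main "HOL-Computational_Algebra.Primes" "HOL-Algebra.Sym_Groups"
begin

(* cycle_of_list cs is the identity off the set of cs, so sigma is a single cycle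
   of length l together with fixed points.  The condition l > 1 excludes the identity,
   which is cycle_of_list of any list of length at most one. *)
definition is_cycle_of_length :: "nat \<Rightarrow> (nat \<Rightarrow> nat) \<Rightarrow> bool" where
  "is_cycle_of_length l \<sigma> \<longleftrightarrow>
     l > 1 \<and> (\<exists>cs. distinct cs \<and> length cs = l \<and> \<sigma> = cycle_of_list cs)"

definition perm_proportion :: "nat \<Rightarrow> ((nat \<Rightarrow> nat) \<Rightarrow> bool) \<Rightarrow> real" where
  "perm_proportion n P = real (card {\<sigma> \<in> carrier (sym_group n). P \<sigma>}) / fact n"

end

theory Submission
  imports Defs "HOL-Number_Theory.Cong" "HOL-Computational_Algebra.Squarefree"
    "HOL-Analysis.Harmonic_Numbers" "HOL-Real_Asymp.Real_Asymp"
begin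

text \<open>
  Let \<open>N = ln n powr (3/2)\<close>.  The number of cycles whose length is a prime in \<open>(N, n]\<close> has mean
  \<open>\<mu> = (\<Sum>p. 1/p)\<close> and variance at most \<open>\<mu>\<close>, so by Chebyshev's inequality some such cycle exists
  except with probability \<open>1/\<mu>\<close>.  The expected number of pairs of a \<open>p\<close>-cycle and another cycle of
  length divisible by \<open>p\<close>, for such \<open>p\<close>, is at most \<open>(\<Sum>p. 1/p\<^sup>2 * harm n) \<le> harm n / N\<close>, which tends
  to \<open>0\<close>.  If \<open>\<sigma>\<close> has a \<open>p\<close>-cycle and all its other cycle lengths are prime to \<open>p\<close>, then a power
  of \<open>\<sigma>\<close> whose exponent is \<open>1\<close> modulo \<open>p\<close> and divisible by all the other lengths is that \<open>p\<close>-cycle.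

  It remains to see that \<open>\<mu>\<close> is unbounded: the sum of \<open>1/p\<close> up to \<open>n\<close> is at least
  \<open>ln (ln n) - ln 2\<close>, whereas restricting to \<open>p \<le> N\<close> gives at most half the harmonic sum, that is,
  \<open>3/4 * ln (ln n) + 1\<close>.
\<close>

section \<open>Sums over primes\<close>

text \<open>Telescoping: each term \<open>1 / k^2\<close> is at most
  \<open>1 / (k - 1) - 1 / k\<close>. The case \<open>N = 1\<close> bounds the full series by
  \<open>2\<close>; large \<open>N\<close> controls the tail over primes beyond
  \<open>N\<close>.\<close>

lemma sum_inverse_squares_le:
  assumes "N \<ge> 1"
  shows "(\<Sum>k\<in>{N<..n}. 1 / real k ^ 2) \<le> 1 / real N"
proof -
  have "(\<Sum>k\<in>{N<..n}. 1 / real k ^ 2) \<le> 1 / real N - 1 / real n" if "N \<le> n"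
    using that
  proof (induction n rule: dec_induct)
    case base
    then show ?case by simp
  next
    case (step n)
    have "{N<..Suc n} = insert (Suc n) {N<..n}" using step by auto
    moreover have "1 / real (Suc n) ^ 2 \<le> 1 / real n - 1 / real (Suc n)"
    proof -
      have "1 / real (Suc n) ^ 2 \<le> 1 / (real n * real (Suc n))"
        using step assms by (intro frac_le) (auto simp: power2_eq_square)
      also have "\<dots> = 1 / real n - 1 / real (Suc n)"
        using step assms by (simp add: field_simps)
      finally show ?thesis .
    qed
    ultimately show ?case using step by simp
  qed
  moreover have "{N<..n} = {}" if "\<not> N \<le> n" using that by auto
  ultimately show ?thesis
    by (cases "N \<le> n") (auto intro: order_trans)
qed

text \<open>All multiplicities are \<open>1\<close>, so a squarefree number can be recovered from
  its set of prime factors. This makes the encoding of \<open>m\<close> in the next lemma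
  injective.\<close>

lemma prod_prime_factors_squarefree:
  fixes s :: nat
  assumes "squarefree s"
  shows "\<Prod>(prime_factors s) = s"
proof -
  have s0: "s \<noteq> 0" using assms by (metis not_squarefree_0)
  have "\<Prod>(prime_factors s) = (\<Prod>p\<in>prime_factors s. p ^ multiplicity p s)"
  proof (rule prod.cong[OF refl])
    fix p assume "p \<in> prime_factors s"
    then have "multiplicity p s = 1"
      using assms squarefree_factorial_semiring''[OF s0] prime_factors_multiplicity[of s]
      by (metis (no_types, lifting) One_nat_def in_prime_factors_iff le_antisym mem_Collect_eq Suc_leI)
    then show "p = p ^ multiplicity p s" by simp
  qed
  also have "\<dots> = s" using prod_prime_factors[OF s0] by simp
  finally show ?thesis .
qed

text \<open>Erdos' idea: every \<open>m\<close> is a squarefree number times a square.\<close>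
lemma harm_le_prod_primes:
  "harm n \<le> 2 * (\<Prod>p | prime p \<and> p \<le> n. 1 + 1 / real p)"
proof -
  define P where "P = {p::nat. prime p \<and> p \<le> n}"
  have finP: "finite P" unfolding P_def by simp
  \<comment> \<open>\<open>?g\<close> encodes \<open>m = s * k^2\<close> with \<open>s\<close>
    squarefree as the pair (primes of \<open>s\<close>, \<open>k\<close>); the weight
    \<open>?w\<close> of this pair is \<open>1 / m\<close>.\<close>
  let ?g = "\<lambda>m::nat. (prime_factors (squarefree_part m), square_part m)"
  let ?w = "\<lambda>(A, k). (\<Prod>p\<in>A. 1 / real p) * (1 / real k ^ 2)"
  have dec: "\<Prod>(fst (?g m)) * snd (?g m) ^ 2 = m" for m
    using squarefree_decompose[of m] prod_prime_factors_squarefree[OF squarefree_squarefree_part[of m]]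
    by simp
  have inj: "inj_on ?g {1..n}"
    by (rule inj_on_inverseI[where g = "\<lambda>(A, k). \<Prod>A * k ^ 2"]) (use dec in simp)
  have sub: "?g ` {1..n} \<subseteq> Pow P \<times> {1..n}"
  proof
    fix z assume "z \<in> ?g ` {1..n}"
    then obtain m where m: "m \<in> {1..n}" "z = ?g m" by blast
    have "square_part m ^ 2 dvd m" "squarefree_part m dvd m"
      using squarefree_decompose[of m] by (metis dvd_triv_right, metis dvd_triv_left)
    then have "square_part m ^ 2 \<le> n" "squarefree_part m \<le> n"
      using m dvd_imp_le[of "square_part m ^ 2" m] dvd_imp_le[of "squarefree_part m" m] by auto
    moreover have "square_part m \<le> square_part m ^ 2" by (simp add: power2_eq_square)
    moreover have "square_part m > 0" using m by (simp add: zero_less_iff_neq_zero)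
    moreover have "prime_factors (squarefree_part m) \<subseteq> P"
      using \<open>squarefree_part m \<le> n\<close> dvd_imp_le[of _ "squarefree_part m"] squarefree_part_nonzero[of m]
      unfolding P_def by (auto simp: in_prime_factors_iff intro: order_trans)
    ultimately show "z \<in> Pow P \<times> {1..n}" using m by auto
  qed
  have "harm n = (\<Sum>m\<in>{1..n}. ?w (?g m))"
    unfolding harm_def
  proof (rule sum.cong[OF refl])
    fix m assume "m \<in> {1..n}"
    have "real m = (\<Prod>p\<in>fst (?g m). real p) * real (snd (?g m)) ^ 2"
      using arg_cong[OF dec[of m], of real] by simp
    then show "inverse (real m) = ?w (?g m)"
      by (simp add: prod_dividef inverse_eq_divide)
  qed
  also have "\<dots> = sum ?w (?g ` {1..n})"
    using sum.reindex[OF inj, of ?w] by simp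
  \<comment> \<open>Enlarging the image of \<open>?g\<close> to a full product makes the sum factor.
    The sum over subsets of \<open>P\<close> is then the expansion of the product of the
    \<open>1 + 1 / p\<close>.\<close>
  also have "\<dots> \<le> sum ?w (Pow P \<times> {1..n})"
    using finP sub by (intro sum_mono2) (auto intro!: divide_nonneg_nonneg prod_nonneg)
  also have "\<dots> = (\<Sum>A\<in>Pow P. \<Prod>p\<in>A. 1 / real p) * (\<Sum>k\<in>{1..n}. 1 / real k ^ 2)"
    by (simp add: sum_product sum.cartesian_product)
  also have "\<dots> \<le> (\<Prod>p\<in>P. 1 + 1 / real p) * 2"
  proof (rule mult_mono)
    show "(\<Sum>A\<in>Pow P. \<Prod>p\<in>A. 1 / real p) \<le> (\<Prod>p\<in>P. 1 + 1 / real p)"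
      using prod_add[OF finP, of "\<lambda>p. 1 / real p" "\<lambda>_. 1"] by (simp add: add.commute)
    show "(\<Sum>k\<in>{1..n}. 1 / real k ^ 2) \<le> 2"
    proof (cases "n \<ge> 1")
      case True
      then have "{1..n} = insert 1 {1<..n}" by auto
      then show ?thesis using sum_inverse_squares_le[of 1 n] by simp
    qed simp
  qed (auto intro!: prod_nonneg sum_nonneg)
  finally show ?thesis unfolding P_def by (simp add: mult.commute)
qed

text \<open>By \<open>1 + x \<le> exp x\<close>, the product bound on \<open>harm n\<close> becomes
  \<open>ln n \<le> 2 * exp (\<Sum>p. 1 / p)\<close>; a further logarithm gives the claim, with
  \<open>ln 2\<close> coming from the factor \<open>2\<close>.\<close>

lemma sum_inverse_primes_ge:
  assumes "n \<ge> 2"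
  shows "(\<Sum>p | prime p \<and> p \<le> n. 1 / real p) \<ge> ln (ln (real n)) - ln 2"
proof -
  have "ln (real n) \<le> ln (real n + 1)" using assms by simp
  also have "\<dots> \<le> harm n" by (rule ln_le_harm)
  also have "\<dots> \<le> 2 * (\<Prod>p | prime p \<and> p \<le> n. 1 + 1 / real p)"
    by (rule harm_le_prod_primes)
  also have "(\<Prod>p | prime p \<and> p \<le> n. 1 + 1 / real p) \<le> (\<Prod>p | prime p \<and> p \<le> n. exp (1 / real p))"
    by (intro prod_mono) (auto intro: exp_ge_add_one_self add_nonneg_nonneg)
  also have "\<dots> = exp (\<Sum>p | prime p \<and> p \<le> n. 1 / real p)"
    by (simp add: exp_sum)
  finally have "ln (ln (real n)) \<le> ln (2 * exp (\<Sum>p | prime p \<and> p \<le> n. 1 / real p))"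
    using assms by (intro ln_mono) auto
  then show ?thesis by (simp add: ln_mult)
qed

text \<open>The sequence \<open>harm n - ln n\<close> is decreasing and has the value
  \<open>1\<close> at \<open>n = 1\<close>.\<close>

lemma harm_le_ln:
  assumes "n \<ge> 1"
  shows "harm n \<le> 1 + ln (real n)"
  using euler_mascheroni_sequence_decreasing[of 1 n] assms by (simp add: harm_expand)

text \<open>The factor \<open>1/2\<close> from dropping the even numbers is essential: for \<open>N = ln n powr (3/2)\<close> the full
  harmonic sum is about \<open>3/2 * ln (ln n)\<close> and would exceed the sum over all primes up to \<open>n\<close>.\<close>
lemma sum_inverse_primes_le:
  "(\<Sum>p | prime p \<and> p \<le> N. 1 / real p) \<le> 1 / 2 + harm N / 2"
proof -
  \<comment> \<open>These odd numbers run up to \<open>2 * N + 1\<close> rather than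
    \<open>N\<close>. The overshoot costs only a bounded amount and turns the sum into half of
    \<open>harm N\<close>.\<close>
  let ?odd = "(\<lambda>k::nat. 2 * k + 1) ` {1..N}"
  have "{p. prime p \<and> p \<le> N} \<subseteq> insert 2 ?odd"
  proof
    fix p assume "p \<in> {p. prime p \<and> p \<le> N}"
    then have p: "prime p" "p \<le> N" by auto
    show "p \<in> insert 2 ?odd"
    proof (cases "p = 2")
      case False
      then have "odd p" "p \<ge> 2" using p prime_odd_nat[of p] prime_ge_2_nat[of p] by auto
      then obtain k where "p = 2 * k + 1" by (auto elim: oddE)
      then show ?thesis using p(2) \<open>p \<ge> 2\<close> by auto
    qed simp
  qed
  then have "(\<Sum>p | prime p \<and> p \<le> N. 1 / real p) \<le> (\<Sum>p\<in>insert 2 ?odd. 1 / real p)"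
    by (intro sum_mono2) auto
  also have "\<dots> \<le> 1 / 2 + (\<Sum>p\<in>?odd. 1 / real p)"
    by (subst sum.insert_if) auto
  also have "(\<Sum>p\<in>?odd. 1 / real p) = (\<Sum>k=1..N. 1 / real (2 * k + 1))"
    by (subst sum.reindex) (auto simp: inj_on_def)
  also have "\<dots> \<le> (\<Sum>k=1..N. inverse (real k) / 2)"
    by (intro sum_mono) (auto simp: field_simps)
  also have "\<dots> = harm N / 2"
    by (simp add: harm_def sum_divide_distrib)
  finally show ?thesis by simp
qed

lemma sum_inverse_multiples_le:
  assumes "p > 0"
  shows "(\<Sum>b | b \<in> {1..n} \<and> p dvd b. 1 / real b) \<le> harm n / real p"
proof -
  have "{b. b \<in> {1..n} \<and> p dvd b} \<subseteq> (\<lambda>j. p * j) ` {1..n}"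
  proof
    fix b assume "b \<in> {b. b \<in> {1..n} \<and> p dvd b}"
    then obtain j where j: "b = p * j" "1 \<le> b" "b \<le> n" by auto
    moreover have "j \<le> p * j" using assms by simp
    ultimately have "j \<in> {1..n}" by (cases j) auto
    then show "b \<in> (\<lambda>j. p * j) ` {1..n}" using j by blast
  qed
  then have "(\<Sum>b | b \<in> {1..n} \<and> p dvd b. 1 / real b) \<le> (\<Sum>b\<in>(\<lambda>j. p * j) ` {1..n}. 1 / real b)"
    by (intro sum_mono2) auto
  also have "\<dots> = (\<Sum>j\<in>{1..n}. 1 / real (p * j))"
    using assms by (subst sum.reindex) (auto simp: inj_on_def)
  also have "\<dots> = harm n / real p"
    by (simp add: harm_def sum_divide_distrib inverse_eq_divide mult.commute)
  finally show ?thesis .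
qed

section \<open>Counting permutations by their cycles\<close>

text \<open>If some \<rho> agrees with \<open>f\<close> on \<open>T\<close>, composing with its
  inverse sends all such permutations injectively to permutations fixing \<open>T\<close> pointwise.
  If there is none, the set is empty.\<close>

lemma card_permutes_agree_le:
  assumes "finite S" "T \<subseteq> S"
  shows "card {\<sigma>. \<sigma> permutes S \<and> (\<forall>x\<in>T. \<sigma> x = f x)} \<le> fact (card S - card T)"
proof (cases "{\<sigma>. \<sigma> permutes S \<and> (\<forall>x\<in>T. \<sigma> x = f x)} = {}")
  case True
  then show ?thesis by (metis card.empty zero_le)
next
  case False
  then obtain \<rho> where \<rho>: "\<rho> permutes S" "\<forall>x\<in>T. \<rho> x = f x" by auto
  let ?A = "{\<sigma>. \<sigma> permutes S \<and> (\<forall>x\<in>T. \<sigma> x = f x)}"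
  have "inj_on (\<lambda>\<sigma>. Hilbert_Choice.inv \<rho> \<circ> \<sigma>) ?A"
  proof (rule inj_onI)
    fix \<sigma> \<tau> assume "Hilbert_Choice.inv \<rho> \<circ> \<sigma> = Hilbert_Choice.inv \<rho> \<circ> \<tau>"
    then have "\<rho> \<circ> (Hilbert_Choice.inv \<rho> \<circ> \<sigma>) = \<rho> \<circ> (Hilbert_Choice.inv \<rho> \<circ> \<tau>)" by simp
    then show "\<sigma> = \<tau>"
      by (simp add: comp_assoc[symmetric] permutes_inv_o(1)[OF \<rho>(1)])
  qed
  moreover have "(\<lambda>\<sigma>. Hilbert_Choice.inv \<rho> \<circ> \<sigma>) ` ?A \<subseteq> {\<tau>. \<tau> permutes (S - T)}"
  proof clarify
    fix \<sigma> assume \<sigma>: "\<sigma> permutes S" "\<forall>x\<in>T. \<sigma> x = f x"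
    have "Hilbert_Choice.inv \<rho> \<circ> \<sigma> permutes S"
      using \<sigma>(1) \<rho>(1) by (intro permutes_compose permutes_inv)
    moreover have "(Hilbert_Choice.inv \<rho> \<circ> \<sigma>) x = x" if "x \<in> T" for x
    proof -
      have "\<sigma> x = \<rho> x" using \<sigma>(2) \<rho>(2) that by simp
      then show ?thesis using permutes_inverses(2)[OF \<rho>(1)] by simp
    qed
    ultimately show "Hilbert_Choice.inv \<rho> \<circ> \<sigma> permutes (S - T)"
      by (rule permutes_superset) auto
  qed
  moreover have "finite {\<tau>. \<tau> permutes (S - T)}"
    using assms by (simp add: finite_permutations)
  ultimately have "card ?A \<le> card {\<tau>. \<tau> permutes (S - T)}"
    by (rule card_inj_on_le)
  also have "\<dots> = fact (card S - card T)"
    using assms by (subst card_permutations[OF refl]) (auto simp: card_Diff_subset finite_subset)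
  finally show ?thesis .
qed

lemma finite_permutes_agree_lists:
  assumes "finite S"
  shows "finite {(es, \<sigma>). length es = k \<and> distinct es \<and> set es \<subseteq> S \<and> \<sigma> permutes S \<and>
                          (\<forall>x\<in>set es. \<sigma> x = F es x)}"
  by (rule finite_subset[of _ "{es. set es \<subseteq> S \<and> length es = k} \<times> {\<sigma>. \<sigma> permutes S}"])
     (use assms in \<open>auto simp: finite_lists_length_eq finite_permutations\<close>)

text \<open>There are \<open>n! / (n - k)!\<close> lists, and each prescribes \<sigma> at
  \<open>k\<close> points, leaving at most \<open>(n - k)!\<close> choices. Thus, on average over
  \<sigma>, at most one list is compatible, whatever the rule \<open>F\<close>.\<close>

lemma card_permutes_agree_lists_le:
  assumes "finite S"
  shows "card {(es, \<sigma>). length es = k \<and> distinct es \<and> set es \<subseteq> S \<and> \<sigma> permutes S \<and>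
                        (\<forall>x\<in>set es. \<sigma> x = F es x)} \<le> fact (card S)"
proof (cases "k \<le> card S")
  case True
  let ?L = "{es. length es = k \<and> distinct es \<and> set es \<subseteq> S}"
  have finL: "finite ?L"
    by (rule finite_subset[OF _ finite_lists_length_eq[OF assms, of k]]) auto
  have "{(es, \<sigma>). length es = k \<and> distinct es \<and> set es \<subseteq> S \<and> \<sigma> permutes S \<and>
                  (\<forall>x\<in>set es. \<sigma> x = F es x)}
      = (SIGMA es : ?L. {\<sigma>. \<sigma> permutes S \<and> (\<forall>x\<in>set es. \<sigma> x = F es x)})"
    by auto
  also have "card \<dots> = (\<Sum>es\<in>?L. card {\<sigma>. \<sigma> permutes S \<and> (\<forall>x\<in>set es. \<sigma> x = F es x)})"
    using assms finL by (intro card_SigmaI) (auto simp: finite_permutations)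
  also have "\<dots> \<le> (\<Sum>es\<in>?L. fact (card S - k))"
  proof (rule sum_mono)
    fix es assume "es \<in> ?L"
    then show "card {\<sigma>. \<sigma> permutes S \<and> (\<forall>x\<in>set es. \<sigma> x = F es x)} \<le> fact (card S - k)"
      using card_permutes_agree_le[OF assms, of "set es" "F es"] by (auto simp: distinct_card)
  qed
  also have "\<dots> = \<Prod>{card S - k + 1 .. card S} * fact (card S - k)"
    using card_lists_distinct_length_eq[OF assms True] by simp
  also have "\<dots> = fact (card S)"
    using prod.ub_add_nat[of 1 "card S - k" "\<lambda>i. i" k] True
    by (simp add: fact_prod mult.commute)
  finally show ?thesis .
next
  case False
  have empty: "\<not> (length es = k \<and> distinct es \<and> set es \<subseteq> S)" for es
    using False assms by (metis card_mono distinct_card)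
  have "{(es, \<sigma>). length es = k \<and> distinct es \<and> set es \<subseteq> S \<and> \<sigma> permutes S \<and>
                  (\<forall>x\<in>set es. \<sigma> x = F es x)} = {}"
    using empty by blast
  then show ?thesis by (metis card.empty zero_le)
qed

section \<open>Cycles as lists starting at a chosen point, and points sorted by period\<close>

definition cycle_at :: "('a \<Rightarrow> 'a) \<Rightarrow> 'a \<Rightarrow> 'a list" where
  "cycle_at \<sigma> x = support \<sigma> x"

text \<open>Points are counted instead of cycles: an \<open>a\<close>-cycle contributes
  \<open>a\<close> points, so the number of \<open>a\<close>-cycles is the cardinality divided by
  \<open>a\<close>.\<close>

definition period_points :: "'a set \<Rightarrow> ('a \<Rightarrow> 'a) \<Rightarrow> nat \<Rightarrow> 'a set" where
  "period_points S \<sigma> a = {x \<in> S. least_power \<sigma> x = a}"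

text \<open>Each ordered pair of different cycles of lengths \<open>a\<close> and \<open>b\<close>
  contributes \<open>a * b\<close> pairs of points.\<close>

definition period_pairs :: "'a set \<Rightarrow> ('a \<Rightarrow> 'a) \<Rightarrow> nat \<Rightarrow> nat \<Rightarrow> ('a \<times> 'a) set" where
  "period_pairs S \<sigma> a b =
     {(x, y). x \<in> period_points S \<sigma> a \<and> y \<in> period_points S \<sigma> b \<and> y \<notin> set (cycle_at \<sigma> x)}"

lemma finite_period_points [simp]: "finite S \<Longrightarrow> finite (period_points S \<sigma> a)"
  by (simp add: period_points_def)

lemma finite_period_pairs [simp]: "finite S \<Longrightarrow> finite (period_pairs S \<sigma> a b)"
  by (rule finite_subset[of _ "S \<times> S"]) (auto simp: period_pairs_def period_points_def)

lemma set_cycle_at_subset: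
  assumes "\<sigma> permutes S" "x \<in> S"
  shows "set (cycle_at \<sigma> x) \<subseteq> S"
  using assms permutes_in_image[OF permutes_funpow[OF assms(1)]] by (auto simp: cycle_at_def)

lemma permutation_if_permutes:
  "\<sigma> permutes S \<Longrightarrow> finite S \<Longrightarrow> permutation \<sigma>"
  using permutation_permutes by blast

lemma length_cycle_at [simp]: "length (cycle_at \<sigma> x) = least_power \<sigma> x"
  by (simp add: cycle_at_def)

lemma cycle_at_nth_0:
  assumes "permutation \<sigma>"
  shows "cycle_at \<sigma> x ! 0 = x"
  using least_power_of_permutation(2)[OF assms, of x] by (simp add: cycle_at_def)

lemma self_in_cycle_at:
  assumes "permutation \<sigma>"
  shows "x \<in> set (cycle_at \<sigma> x)"
  by (metis assms cycle_at_nth_0 length_cycle_at least_power_of_permutation(2) nth_mem)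

lemma distinct_cycle_at:
  assumes "permutation \<sigma>"
  shows "distinct (cycle_at \<sigma> x)"
  using cycle_of_permutation[OF assms] by (simp add: cycle_at_def)

lemma cycle_of_list_cycle_at:
  assumes "permutation \<sigma>" "y \<in> set (cycle_at \<sigma> x)"
  shows "cycle_of_list (cycle_at \<sigma> x) y = \<sigma> y"
  using cycle_restrict[OF assms(1)] assms(2) unfolding cycle_at_def by metis

lemma card_set_cycle_at:
  assumes "permutation \<sigma>"
  shows "card (set (cycle_at \<sigma> x)) = least_power \<sigma> x"
  using distinct_card[OF distinct_cycle_at[OF assms]] by simp

lemma set_cycle_at_disjoint:
  assumes "permutation \<sigma>" "y \<notin> set (cycle_at \<sigma> x)"
  shows "set (cycle_at \<sigma> y) \<inter> set (cycle_at \<sigma> x) = {}"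
  using disjoint_support'[OF assms(1)] assms(2) unfolding cycle_at_def by blast

lemma set_cycle_at_eq:
  assumes "permutation \<sigma>" "y \<in> set (cycle_at \<sigma> x)"
  shows "set (cycle_at \<sigma> y) = set (cycle_at \<sigma> x)"
proof -
  have "set (cycle_at \<sigma> y) \<inter> set (cycle_at \<sigma> x) \<noteq> {}"
    using self_in_cycle_at[OF assms(1)] assms(2) by blast
  then show ?thesis
    using disjointD[OF disjoint_support[OF assms(1)], OF rangeI rangeI]
    unfolding cycle_at_def by metis
qed

lemma least_power_eq_if_in_cycle_at:
  assumes "permutation \<sigma>" "y \<in> set (cycle_at \<sigma> x)"
  shows "least_power \<sigma> y = least_power \<sigma> x"
  using set_cycle_at_eq[OF assms] card_set_cycle_at[OF assms(1)] by metis

lemma least_power_le_card: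
  assumes "\<sigma> permutes S" "finite S" "x \<in> S"
  shows "least_power \<sigma> x \<le> card S"
  using card_mono[OF assms(2) set_cycle_at_subset[OF assms(1,3)]]
    card_set_cycle_at[OF permutation_if_permutes[OF assms(1,2)]] by simp

section \<open>Averages over all permutations of the numbers of points and pairs\<close>

text \<open>A point \<open>x\<close> of period \<open>a\<close> is encoded by its cycle, written as
  a list starting at \<open>x\<close>. The list prescribes \<sigma> on its \<open>a\<close> entries,
  so the count of compatible lists applies.\<close>

lemma sum_card_period_points_le:
  assumes "finite S"
  shows "(\<Sum>\<sigma> | \<sigma> permutes S. card (period_points S \<sigma> a)) \<le> fact (card S)"
proof -
  let ?D = "SIGMA \<sigma> : {\<sigma>. \<sigma> permutes S}. period_points S \<sigma> a"
  let ?E = "{(es, \<sigma>). length es = a \<and> distinct es \<and> set es \<subseteq> S \<and> \<sigma> permutes S \<and>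
                      (\<forall>x\<in>set es. \<sigma> x = cycle_of_list es x)}"
  let ?g = "\<lambda>(\<sigma>, x). (cycle_at \<sigma> x, \<sigma>)"
  have "inj_on ?g ?D"
    using cycle_at_nth_0[OF permutation_if_permutes[OF _ assms]]
    by (auto simp: inj_on_def) metis
  moreover have "?g ` ?D \<subseteq> ?E"
  proof
    fix z assume "z \<in> ?g ` ?D"
    then obtain \<sigma> x where *: "\<sigma> permutes S" "x \<in> period_points S \<sigma> a"
      and z: "z = (cycle_at \<sigma> x, \<sigma>)" by auto
    then have **: "permutation \<sigma>" "x \<in> S" "least_power \<sigma> x = a"
      using assms by (auto simp: period_points_def permutation_if_permutes)
    have "length (cycle_at \<sigma> x) = a \<and> distinct (cycle_at \<sigma> x) \<and> set (cycle_at \<sigma> x) \<subseteq> S \<and>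
          \<sigma> permutes S \<and> (\<forall>y\<in>set (cycle_at \<sigma> x). \<sigma> y = cycle_of_list (cycle_at \<sigma> x) y)"
      using * ** set_cycle_at_subset[OF *(1) **(2)] distinct_cycle_at[OF **(1)]
        cycle_of_list_cycle_at[OF **(1)] by simp
    then show "z \<in> ?E" unfolding z by blast
  qed
  ultimately have "card ?D \<le> card ?E"
    by (rule card_inj_on_le[OF _ _ finite_permutes_agree_lists[OF assms]])
  also have "\<dots> \<le> fact (card S)"
    by (rule card_permutes_agree_lists_le[OF assms])
  finally show ?thesis
    using assms by (simp add: card_SigmaI finite_permutations)
qed

text \<open>The upper bound is attained for all periods at once, because the periods \<open>1, \<dots>, card S\<close>
  of every permutation share all \<open>card S\<close> points.\<close>
lemma sum_card_period_points:
  assumes "finite S" "a \<in> {1..card S}"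
  shows "(\<Sum>\<sigma> | \<sigma> permutes S. card (period_points S \<sigma> a)) = fact (card S)"
proof (rule ccontr)
  let ?f = "\<lambda>a. \<Sum>\<sigma> | \<sigma> permutes S. card (period_points S \<sigma> a)"
  assume "?f a \<noteq> fact (card S)"
  then have "(\<Sum>b\<in>{1..card S}. ?f b) < (\<Sum>b\<in>{1..card S}. fact (card S))"
    using assms sum_card_period_points_le[OF assms(1)]
    by (intro sum_strict_mono_ex1) (auto simp: order_less_le)
  moreover have "(\<Sum>b\<in>{1..card S}. ?f b) = (\<Sum>\<sigma> | \<sigma> permutes S. \<Sum>b\<in>{1..card S}. card (period_points S \<sigma> b))"
    by (rule sum.swap)
  moreover have "(\<Sum>b\<in>{1..card S}. card (period_points S \<sigma> b)) = card S" if "\<sigma> permutes S" for \<sigma>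
  proof -
    have "(\<Sum>b\<in>{1..card S}. card (period_points S \<sigma> b)) = card (\<Union>b\<in>{1..card S}. period_points S \<sigma> b)"
      using assms by (intro card_UN_disjoint[symmetric]) (auto simp: period_points_def)
    also have "(\<Union>b\<in>{1..card S}. period_points S \<sigma> b) = S"
      using least_power_le_card[OF that assms(1)]
        least_power_of_permutation(2)[OF permutation_if_permutes[OF that assms(1)]]
      by (auto simp: period_points_def Suc_le_eq)
    finally show ?thesis .
  qed
  ultimately show False
    using assms by (simp add: card_permutations)
qed

text \<open>The same encoding, with the two disjoint cycles concatenated into one list of length
  \<open>a + b\<close>.\<close>

lemma sum_card_period_pairs_le:
  assumes "finite S"
  shows "(\<Sum>\<sigma> | \<sigma> permutes S. card (period_pairs S \<sigma> a b)) \<le> fact (card S)"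
proof -
  let ?D = "SIGMA \<sigma> : {\<sigma>. \<sigma> permutes S}. period_pairs S \<sigma> a b"
  \<comment> \<open>Cutting the list after \<open>a\<close> entries recovers the two cycles, and
    with them the prescribed values of \<sigma>.\<close>
  let ?F = "\<lambda>es x. if x \<in> set (take a es) then cycle_of_list (take a es) x
                   else cycle_of_list (drop a es) x"
  let ?E = "{(es, \<sigma>). length es = a + b \<and> distinct es \<and> set es \<subseteq> S \<and> \<sigma> permutes S \<and>
                      (\<forall>x\<in>set es. \<sigma> x = ?F es x)}"
  let ?g = "\<lambda>(\<sigma>, x, y). (cycle_at \<sigma> x @ cycle_at \<sigma> y, \<sigma>)"
  have props: "permutation \<sigma>" "x \<in> S" "least_power \<sigma> x = a" "y \<in> S" "least_power \<sigma> y = b"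
      "length (cycle_at \<sigma> x) = a" "length (cycle_at \<sigma> y) = b"
      "y \<notin> set (cycle_at \<sigma> x)"
    if "\<sigma> permutes S" "(x, y) \<in> period_pairs S \<sigma> a b" for \<sigma> x y
    using that assms by (auto simp: period_pairs_def period_points_def permutation_if_permutes)
  have "inj_on ?g ?D"
  proof (rule inj_onI)
    fix u v assume uv: "u \<in> ?D" "v \<in> ?D" "?g u = ?g v"
    obtain \<sigma> x y where u: "u = (\<sigma>, x, y)" by (cases u)
    obtain \<sigma>' x' y' where v: "v = (\<sigma>', x', y')" by (cases v)
    have [simp]: "\<sigma>' = \<sigma>" using uv u v by simp
    have *: "\<sigma> permutes S" "(x, y) \<in> period_pairs S \<sigma> a b" "(x', y') \<in> period_pairs S \<sigma> a b"
      and eq: "cycle_at \<sigma> x @ cycle_at \<sigma> y = cycle_at \<sigma> x' @ cycle_at \<sigma> y'"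
      using uv u v by auto
    have "cycle_at \<sigma> x = cycle_at \<sigma> x' \<and> cycle_at \<sigma> y = cycle_at \<sigma> y'"
      using eq props[OF *(1,2)] props[OF *(1,3)] by (metis append_eq_append_conv)
    then have "x = x' \<and> y = y'"
      using cycle_at_nth_0[OF permutation_if_permutes[OF *(1) assms]] by metis
    then show "u = v" using u v by simp
  qed
  moreover have "?g ` ?D \<subseteq> ?E"
  proof
    fix z assume "z \<in> ?g ` ?D"
    then obtain \<sigma> x y where *: "\<sigma> permutes S" "(x, y) \<in> period_pairs S \<sigma> a b"
      and z: "z = (cycle_at \<sigma> x @ cycle_at \<sigma> y, \<sigma>)" by auto
    note p = props[OF *]
    define u where "u = cycle_at \<sigma> x"
    define v where "v = cycle_at \<sigma> y"
    have "set u \<inter> set v = {}"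
      using set_cycle_at_disjoint[OF p(1,8)] unfolding u_def v_def by blast
    moreover have "length u = a" "length v = b" "distinct u" "distinct v" "set u \<subseteq> S" "set v \<subseteq> S"
      using p(6,7) distinct_cycle_at[OF p(1)] set_cycle_at_subset[OF *(1)] p(2,4)
      unfolding u_def v_def by blast+
    moreover have "\<forall>z\<in>set u. \<sigma> z = cycle_of_list u z" "\<forall>z\<in>set v. \<sigma> z = cycle_of_list v z"
      using cycle_of_list_cycle_at[OF p(1)] unfolding u_def v_def by simp_all
    ultimately have "length (u @ v) = a + b \<and> distinct (u @ v) \<and> set (u @ v) \<subseteq> S \<and>
          \<sigma> permutes S \<and> (\<forall>z\<in>set (u @ v). \<sigma> z = ?F (u @ v) z)"
      using *(1) by auto
    then show "z \<in> ?E" unfolding z u_def[symmetric] v_def[symmetric] by blast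
  qed
  ultimately have "card ?D \<le> card ?E"
    by (rule card_inj_on_le[OF _ _ finite_permutes_agree_lists[OF assms]])
  also have "\<dots> \<le> fact (card S)"
    by (rule card_permutes_agree_lists_le[OF assms])
  finally show ?thesis
    using assms by (simp add: card_SigmaI finite_permutations)
qed

text \<open>One pair brings with it the whole product of the two cycles, because period and
  disjointness depend only on the cycles and not on the chosen points.\<close>

lemma card_period_pairs_ge:
  assumes "\<sigma> permutes S" "finite S" "(x, y) \<in> period_pairs S \<sigma> a b"
  shows "card (period_pairs S \<sigma> a b) \<ge> a * b"
proof -
  have p: "permutation \<sigma>" "x \<in> S" "least_power \<sigma> x = a" "y \<in> S" "least_power \<sigma> y = b"
    "y \<notin> set (cycle_at \<sigma> x)"
    using assms by (auto simp: period_pairs_def period_points_def permutation_if_permutes)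
  have "(u, v) \<in> period_pairs S \<sigma> a b"
    if "u \<in> set (cycle_at \<sigma> x)" "v \<in> set (cycle_at \<sigma> y)" for u v
  proof -
    have "v \<notin> set (cycle_at \<sigma> u)"
      using that p(6) set_cycle_at_eq[OF p(1)] self_in_cycle_at[OF p(1)] by metis
    then show ?thesis
      using p that set_cycle_at_subset[OF assms(1)] least_power_eq_if_in_cycle_at[OF p(1)]
      unfolding period_pairs_def period_points_def by blast
  qed
  then have "set (cycle_at \<sigma> x) \<times> set (cycle_at \<sigma> y) \<subseteq> period_pairs S \<sigma> a b" by blast
  from card_mono[OF finite_period_pairs[OF assms(2)] this] show ?thesis
    using p(3,5) by (simp add: card_cartesian_product card_set_cycle_at[OF p(1)])
qed

text \<open>Two points lie either on different cycles or on the same one. In the latter case the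
  periods agree and each first point has at most \<open>a\<close> partners. This diagonal term
  becomes the variance.\<close>

lemma card_period_points_mult_le:
  assumes "\<sigma> permutes S" "finite S"
  shows "card (period_points S \<sigma> a) * card (period_points S \<sigma> b)
    \<le> card (period_pairs S \<sigma> a b) + (if a = b then a * card (period_points S \<sigma> a) else 0)"
proof -
  note perm = permutation_if_permutes[OF assms]
  let ?D = "SIGMA x : period_points S \<sigma> a. set (cycle_at \<sigma> x) \<inter> period_points S \<sigma> b"
  have "period_points S \<sigma> a \<times> period_points S \<sigma> b \<subseteq> period_pairs S \<sigma> a b \<union> ?D"
    unfolding period_pairs_def by blast
  then have "card (period_points S \<sigma> a \<times> period_points S \<sigma> b) \<le> card (period_pairs S \<sigma> a b \<union> ?D)"
    using assms by (intro card_mono) auto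
  also have "\<dots> \<le> card (period_pairs S \<sigma> a b) + card ?D" by (rule card_Un_le)
  also have "card ?D \<le> (if a = b then a * card (period_points S \<sigma> a) else 0)"
  proof (cases "a = b")
    case True
    have "card ?D = (\<Sum>x\<in>period_points S \<sigma> a. card (set (cycle_at \<sigma> x) \<inter> period_points S \<sigma> b))"
      using assms by (intro card_SigmaI) auto
    also have "\<dots> \<le> (\<Sum>x\<in>period_points S \<sigma> a. a)"
    proof (rule sum_mono)
      fix x assume "x \<in> period_points S \<sigma> a"
      then have "card (set (cycle_at \<sigma> x)) = a"
        using card_set_cycle_at[OF perm, of x] unfolding period_points_def by blast
      then show "card (set (cycle_at \<sigma> x) \<inter> period_points S \<sigma> b) \<le> a"
        by (metis List.finite_set card_mono inf_le1)
    qed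
    finally show ?thesis using True by (simp add: mult.commute)
  next
    case False
    have "?D = {}"
      using False by (auto simp: period_points_def dest: least_power_eq_if_in_cycle_at[OF perm])
    then have "card ?D = 0" by (metis card.empty)
    then show ?thesis by simp
  qed
  finally show ?thesis by (simp add: card_cartesian_product)
qed

section \<open>Isolating one cycle by taking a power\<close>

lemma permutes_power_eq_cycle:
  assumes "\<sigma> permutes S" "finite S" "prime p" "x \<in> S" "least_power \<sigma> x = p"
    and nd: "\<And>y. y \<in> S \<Longrightarrow> y \<notin> set (cycle_at \<sigma> x) \<Longrightarrow> \<not> p dvd least_power \<sigma> y"
  shows "\<exists>m. \<sigma> ^^ m = cycle_of_list (cycle_at \<sigma> x)"
proof -
  note perm = permutation_if_permutes[OF assms(1,2)]
  \<comment> \<open>The product runs over points, so a cycle length occurs once for each point of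
    its cycle. Only two facts matter: every such length divides \<open>M\<close>, and
    \<open>M\<close> is coprime to \<open>p\<close>.\<close>
  define M where "M = (\<Prod>y\<in>S - set (cycle_at \<sigma> x). least_power \<sigma> y)"
  have "coprime M p"
    unfolding M_def using nd assms(3)
    by (intro prod_coprime_left) (auto simp: prime_imp_coprime coprime_commute)
  \<comment> \<open>The factor \<open>k\<close> makes the exponent \<open>1\<close> modulo
    \<open>p\<close>, so that the power acts on the chosen cycle as \<sigma> itself.\<close>
  then obtain k where k: "[M * k = 1] (mod p)"
    using cong_solve_coprime_nat by auto
  have gt1: "p > 1" using assms(3) prime_gt_1_nat by blast
  have "(\<sigma> ^^ (M * k)) y = cycle_of_list (cycle_at \<sigma> x) y" for y
  proof (cases "y \<in> set (cycle_at \<sigma> x)")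
    case True
    have "M * k mod p = 1" using k gt1 by (simp add: unique_euclidean_semiring_class.cong_def)
    then have Mk: "M * k = p * (M * k div p) + 1" by (metis mult_div_mod_eq)
    have "p dvd p * (M * k div p)" by simp
    then have "(\<sigma> ^^ (p * (M * k div p))) y = y"
      using least_power_dvd[OF perm, of y] least_power_eq_if_in_cycle_at[OF perm True] assms(5) by metis
    then have "(\<sigma> ^^ (M * k)) y = \<sigma> y"
      by (subst Mk) simp
    then show ?thesis using cycle_of_list_cycle_at[OF perm True] by metis
  next
    case False
    have "least_power \<sigma> y dvd M * k"
    proof (cases "y \<in> S")
      case True
      then have "least_power \<sigma> y dvd M"
        unfolding M_def using False assms(2) by (intro dvd_prodI) auto
      then show ?thesis by simp
    next
      case False
      then have "(\<sigma> ^^ 1) y = y" using assms(1) by (simp add: permutes_def)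
      then have "least_power \<sigma> y dvd 1" by (rule least_power_minimal)
      then show ?thesis by simp
    qed
    then have "(\<sigma> ^^ (M * k)) y = y" using least_power_dvd[OF perm] by metis
    then show ?thesis using id_outside_supp[OF False] by metis
  qed
  then show ?thesis by blast
qed

text \<open>Connects the integer powers in the group with iteration of functions; nonnegative
  exponents are enough, since only the existence of an exponent is claimed.\<close>

lemma sym_group_int_pow:
  "\<sigma> [^]\<^bsub>sym_group n\<^esub> int m = \<sigma> ^^ m"
proof -
  have "\<sigma> [^]\<^bsub>sym_group n\<^esub> m = \<sigma> ^^ m"
    by (induction m) (auto simp: sym_group_one sym_group_mult nat_pow_def funpow_Suc_right simp del: funpow.simps)
  then show ?thesis by (simp add: int_pow_int)
qed

section \<open>Powers that are cycles of prime length\<close>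

definition prime_cycle_power :: "(nat \<Rightarrow> nat) \<Rightarrow> bool" where
  "prime_cycle_power \<sigma> \<longleftrightarrow> (\<exists>m p. prime p \<and> is_cycle_of_length p (\<sigma> ^^ m))"

text \<open>The absence of pairs says that \<open>p\<close> divides the length of no cycle other
  than the one through \<open>x\<close>, which can therefore be isolated by a power.\<close>

lemma prime_cycle_powerI:
  assumes "\<sigma> permutes S" "finite S" "prime p" "x \<in> period_points S \<sigma> p"
    and "\<And>b. p dvd b \<Longrightarrow> period_pairs S \<sigma> p b = {}"
  shows "prime_cycle_power \<sigma>"
proof -
  note perm = permutation_if_permutes[OF assms(1,2)]
  have x: "x \<in> S" "least_power \<sigma> x = p" using assms(4) by (auto simp: period_points_def)
  have "\<not> p dvd least_power \<sigma> y" if "y \<in> S" "y \<notin> set (cycle_at \<sigma> x)" for y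
    using assms(5)[of "least_power \<sigma> y"] that assms(4)
    by (auto simp: period_pairs_def period_points_def)
  then obtain m where "\<sigma> ^^ m = cycle_of_list (cycle_at \<sigma> x)"
    using permutes_power_eq_cycle[OF assms(1-3) x] by blast
  then have "is_cycle_of_length p (\<sigma> ^^ m)"
    unfolding is_cycle_of_length_def
    using distinct_cycle_at[OF perm, of x] x(2) prime_gt_1_nat[OF assms(3)] by auto
  then show ?thesis unfolding prime_cycle_power_def using assms(3) by blast
qed

text \<open>\<open>X \<sigma>\<close> is the number of cycles of \<open>\<sigma>\<close> with length in \<open>P\<close>, and \<open>\<mu>\<close> is its mean.\<close>
lemma sum_square_deviation_le:
  fixes S :: "nat set"
  assumes "finite S" "finite P" "P \<subseteq> {1..card S}"
  defines "\<mu> \<equiv> \<Sum>p\<in>P. 1 / real p"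
  defines "X \<equiv> \<lambda>\<sigma>. \<Sum>p\<in>P. real (card (period_points S \<sigma> p)) / real p"
  shows "(\<Sum>\<sigma> | \<sigma> permutes S. (X \<sigma> - \<mu>)\<^sup>2) \<le> fact (card S) * \<mu>"
proof -
  let ?M = "\<lambda>\<sigma> p. real (card (period_points S \<sigma> p))"
  let ?Q = "\<lambda>\<sigma> p q. real (card (period_pairs S \<sigma> p q))"
  have M: "(\<Sum>\<sigma> | \<sigma> permutes S. ?M \<sigma> p) = fact (card S)" if "p \<in> P" for p
    using arg_cong[OF sum_card_period_points[OF assms(1), of p], of real] that assms(3)
    unfolding of_nat_sum of_nat_fact by blast
  have Q: "(\<Sum>\<sigma> | \<sigma> permutes S. ?Q \<sigma> p q) \<le> fact (card S)" for p q
    using of_nat_mono[OF sum_card_period_pairs_le[OF assms(1), of p q], where 'a = real]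
    unfolding of_nat_sum of_nat_fact .
  have pos: "p > 0" if "p \<in> P" for p using that assms(3) by auto
  have EX: "(\<Sum>\<sigma> | \<sigma> permutes S. X \<sigma>) = fact (card S) * \<mu>"
  proof -
    have "(\<Sum>\<sigma> | \<sigma> permutes S. X \<sigma>) = (\<Sum>p\<in>P. \<Sum>\<sigma> | \<sigma> permutes S. ?M \<sigma> p / real p)"
      unfolding X_def by (rule sum.swap)
    also have "\<dots> = (\<Sum>p\<in>P. fact (card S) / real p)"
      by (intro sum.cong refl) (simp add: M flip: sum_divide_distrib)
    finally show ?thesis by (simp add: \<mu>_def sum_distrib_left)
  qed
  have EX2: "(\<Sum>\<sigma> | \<sigma> permutes S. (X \<sigma>)\<^sup>2) \<le> fact (card S) * (\<mu>\<^sup>2 + \<mu>)"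
  proof -
    have "(\<Sum>\<sigma> | \<sigma> permutes S. (X \<sigma>)\<^sup>2)
        = (\<Sum>\<sigma> | \<sigma> permutes S. \<Sum>p\<in>P. \<Sum>q\<in>P. ?M \<sigma> p * ?M \<sigma> q / (real p * real q))"
      unfolding X_def power2_eq_square sum_product by simp
    also have "\<dots> \<le> (\<Sum>\<sigma> | \<sigma> permutes S. \<Sum>p\<in>P. \<Sum>q\<in>P.
        (?Q \<sigma> p q + (if p = q then p * ?M \<sigma> p else 0)) / (real p * real q))"
    proof (intro sum_mono divide_right_mono)
      fix \<sigma> p q assume "\<sigma> \<in> {\<sigma>. \<sigma> permutes S}"
      then have "card (period_points S \<sigma> p) * card (period_points S \<sigma> q)
          \<le> card (period_pairs S \<sigma> p q) + (if p = q then p * card (period_points S \<sigma> p) else 0)"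
        using card_period_points_mult_le assms(1) by blast
      then show "?M \<sigma> p * ?M \<sigma> q \<le> ?Q \<sigma> p q + (if p = q then p * ?M \<sigma> p else 0)"
        by (auto simp flip: of_nat_mult of_nat_add split: if_splits)
    qed auto
    also have "\<dots> = (\<Sum>p\<in>P. \<Sum>q\<in>P. \<Sum>\<sigma> | \<sigma> permutes S.
        (?Q \<sigma> p q + (if p = q then p * ?M \<sigma> p else 0)) / (real p * real q))"
      by (subst sum.swap, intro sum.cong refl, rule sum.swap)
    \<comment> \<open>Pairs on different cycles average at most \<open>1 / (p * q)\<close>, in total
      \<open>\<mu>\<^sup>2\<close>; the diagonal terms \<open>p * ?M \<sigma> p / p^2\<close>
      average \<open>1 / p\<close>, in total \<mu>.\<close>
    also have "\<dots> \<le> (\<Sum>p\<in>P. \<Sum>q\<in>P. fact (card S) * (1 / (real p * real q) + (if p = q then 1 / real p else 0)))"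
    proof (intro sum_mono)
      fix p q assume pq: "p \<in> P" "q \<in> P"
      have "(\<Sum>\<sigma> | \<sigma> permutes S. ?Q \<sigma> p q + (if p = q then p * ?M \<sigma> p else 0))
          = (\<Sum>\<sigma> | \<sigma> permutes S. ?Q \<sigma> p q) + (if p = q then p * (\<Sum>\<sigma> | \<sigma> permutes S. ?M \<sigma> p) else 0)"
        by (simp add: sum.distrib sum_distrib_left)
      also have "\<dots> \<le> fact (card S) + (if p = q then p * fact (card S) else 0)"
        using Q[of p q] M[OF pq(1)] by auto
      finally have "(\<Sum>\<sigma> | \<sigma> permutes S. (?Q \<sigma> p q + (if p = q then p * ?M \<sigma> p else 0)) / (real p * real q))
          \<le> (fact (card S) + (if p = q then p * fact (card S) else 0)) / (real p * real q)"
        by (simp only: flip: sum_divide_distrib) (intro divide_right_mono, auto)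
      also have "\<dots> = fact (card S) * (1 / (real p * real q) + (if p = q then 1 / real p else 0))"
        using pos[OF pq(1)] pos[OF pq(2)] by (simp add: field_simps)
      finally show "(\<Sum>\<sigma> | \<sigma> permutes S. (?Q \<sigma> p q + (if p = q then p * ?M \<sigma> p else 0)) / (real p * real q))
          \<le> fact (card S) * (1 / (real p * real q) + (if p = q then 1 / real p else 0))" .
    qed
    also have "\<dots> = fact (card S) * ((\<Sum>p\<in>P. \<Sum>q\<in>P. 1 / (real p * real q)) + (\<Sum>p\<in>P. \<Sum>q\<in>P. if p = q then 1 / real p else 0))"
      by (simp only: sum.distrib flip: sum_distrib_left)
    also have "(\<Sum>p\<in>P. \<Sum>q\<in>P. if p = q then 1 / real p else 0) = \<mu>"
      using assms(2) by (simp add: \<mu>_def)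
    also have "(\<Sum>p\<in>P. \<Sum>q\<in>P. 1 / (real p * real q)) = \<mu>\<^sup>2"
      by (simp add: \<mu>_def power2_eq_square sum_product)
    finally show ?thesis .
  qed
  have "(\<Sum>\<sigma> | \<sigma> permutes S. (X \<sigma> - \<mu>)\<^sup>2)
      = (\<Sum>\<sigma> | \<sigma> permutes S. (X \<sigma>)\<^sup>2 - (2 * \<mu>) * X \<sigma> + \<mu>\<^sup>2)"
    by (intro sum.cong refl) (simp add: power2_diff)
  also have "\<dots> = (\<Sum>\<sigma> | \<sigma> permutes S. (X \<sigma>)\<^sup>2) - (2 * \<mu>) * (\<Sum>\<sigma> | \<sigma> permutes S. X \<sigma>) + fact (card S) * \<mu>\<^sup>2"
    using assms(1) by (simp add: sum.distrib sum_subtractf sum_distrib_left card_permutations)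
  \<comment> \<open>The mean enters with a negative sign, so its exact value \<open>EX\<close> is
    used; an upper bound would not do. The terms in \<open>\<mu>\<^sup>2\<close> then
    cancel.\<close>
  also have "\<dots> \<le> fact (card S) * (\<mu>\<^sup>2 + \<mu>) - (2 * \<mu>) * (fact (card S) * \<mu>) + fact (card S) * \<mu>\<^sup>2"
    using EX2 EX by simp
  also have "\<dots> = fact (card S) * \<mu>" by (simp add: algebra_simps power2_eq_square)
  finally show ?thesis .
qed

text \<open>Every exceptional permutation contributes at least \<open>1\<close> to the sum of a
  normalised square deviation and a weighted count of pairs, both nonnegative. Averaging the first
  is Chebyshev's inequality, averaging the second is Markov's.\<close>

lemma card_not_prime_cycle_power_le:
  fixes S :: "nat set"
  assumes "finite S" "N \<ge> 1" "P = {p. prime p \<and> N < p \<and> p \<le> card S}"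
    and \<mu>_def: "\<mu> = (\<Sum>p\<in>P. 1 / real p)" and "\<mu> > 0"
  shows "card {\<sigma>. \<sigma> permutes S \<and> \<not> prime_cycle_power \<sigma>}
    \<le> fact (card S) * (1 / \<mu> + harm (card S) / real N)"
proof -
  let ?n = "card S"
  have finP: "finite P" using assms(3) by simp
  have P1: "P \<subseteq> {1..?n}" using assms(3) prime_gt_0_nat by (auto simp: Suc_le_eq)
  define B where "B = (\<lambda>p. {b. b \<in> {1..?n} \<and> p dvd b})"
  define X where "X = (\<lambda>\<sigma>. \<Sum>p\<in>P. real (card (period_points S \<sigma> p)) / real p)"
  \<comment> \<open>\<open>Y \<sigma>\<close> is the number of ordered pairs of different cycles
    where the first has length \<open>p\<close> in \<open>P\<close> and the second a length
    divisible by \<open>p\<close>.\<close>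
  define Y where "Y = (\<lambda>\<sigma>. \<Sum>p\<in>P. \<Sum>b\<in>B p. real (card (period_pairs S \<sigma> p b)) / (real p * real b))"
  have Ynn: "Y \<sigma> \<ge> 0" for \<sigma> unfolding Y_def by (intro sum_nonneg) auto
  \<comment> \<open>If no cycle length lies in \<open>P\<close>, then \<open>X \<sigma> = 0\<close>
    and the square equals \<open>1\<close>. Otherwise some \<open>p\<close>-cycle cannot be
    isolated, so a pair counted by \<open>Y\<close> exists.\<close>
  have key: "1 \<le> ((X \<sigma> - \<mu>) / \<mu>)\<^sup>2 + Y \<sigma>"
    if \<sigma>: "\<sigma> permutes S" "\<not> prime_cycle_power \<sigma>" for \<sigma>
  proof (cases "\<exists>p\<in>P. period_points S \<sigma> p \<noteq> {}")
    case True
    then obtain p x where p: "p \<in> P" "x \<in> period_points S \<sigma> p" by blast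
    then obtain b where b: "p dvd b" "period_pairs S \<sigma> p b \<noteq> {}"
      using prime_cycle_powerI[OF \<sigma>(1) assms(1) _ p(2)] \<sigma>(2) assms(3) by blast
    then obtain u v where uv: "(u, v) \<in> period_pairs S \<sigma> p b" by (metis equals0I surj_pair)
    have "v \<in> S" "least_power \<sigma> v = b" using uv by (auto simp: period_pairs_def period_points_def)
    then have bB: "b \<in> B p"
      using b(1) least_power_le_card[OF \<sigma>(1) assms(1), of v]
        least_power_of_permutation(2)[OF permutation_if_permutes[OF \<sigma>(1) assms(1)], of v]
      by (auto simp: B_def)
    have pos: "p > 0" "b > 0" using p(1) P1 bB by (auto simp: B_def)
    have "p * b \<le> card (period_pairs S \<sigma> p b)" by (rule card_period_pairs_ge[OF \<sigma>(1) assms(1) uv])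
    then have "1 \<le> real (card (period_pairs S \<sigma> p b)) / (real p * real b)"
      using pos by (simp add: le_divide_eq flip: of_nat_mult)
    also have "\<dots> \<le> (\<Sum>b\<in>B p. real (card (period_pairs S \<sigma> p b)) / (real p * real b))"
      using bB by (intro member_le_sum) (auto simp: B_def)
    also have "\<dots> \<le> Y \<sigma>"
      unfolding Y_def using p(1) finP
      by (intro member_le_sum[of p P "\<lambda>p. \<Sum>b\<in>B p. real (card (period_pairs S \<sigma> p b)) / (real p * real b)"])
         (auto intro!: sum_nonneg)
    finally show ?thesis by (simp add: add.commute add_increasing2)
  next
    case False
    then have "X \<sigma> = 0" unfolding X_def by auto
    then show ?thesis using Ynn[of \<sigma>] \<open>\<mu> > 0\<close> by simp
  qed
  have EY: "(\<Sum>\<sigma> | \<sigma> permutes S. Y \<sigma>) \<le> fact ?n * (harm ?n / real N)"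
  proof -
    have "(\<Sum>\<sigma> | \<sigma> permutes S. Y \<sigma>)
        = (\<Sum>p\<in>P. \<Sum>b\<in>B p. \<Sum>\<sigma> | \<sigma> permutes S. real (card (period_pairs S \<sigma> p b)) / (real p * real b))"
      unfolding Y_def by (subst sum.swap, intro sum.cong refl, rule sum.swap)
    also have "\<dots> \<le> (\<Sum>p\<in>P. \<Sum>b\<in>B p. fact ?n * (1 / real p) * (1 / real b))"
    proof (intro sum_mono)
      fix p b
      have "(\<Sum>\<sigma> | \<sigma> permutes S. real (card (period_pairs S \<sigma> p b))) \<le> fact ?n"
        using of_nat_mono[OF sum_card_period_pairs_le[OF assms(1), of p b], where 'a = real]
        unfolding of_nat_sum of_nat_fact .
      then have "(\<Sum>\<sigma> | \<sigma> permutes S. real (card (period_pairs S \<sigma> p b))) / (real p * real b)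
          \<le> fact ?n / (real p * real b)"
        by (intro divide_right_mono) auto
      then show "(\<Sum>\<sigma> | \<sigma> permutes S. real (card (period_pairs S \<sigma> p b)) / (real p * real b))
          \<le> fact ?n * (1 / real p) * (1 / real b)"
        by (simp add: sum_divide_distrib)
    qed
    also have "\<dots> = (\<Sum>p\<in>P. fact ?n * (1 / real p) * (\<Sum>b\<in>B p. 1 / real b))"
      by (simp add: sum_distrib_left)
    also have "\<dots> \<le> (\<Sum>p\<in>P. fact ?n * (1 / real p) * (harm ?n / real p))"
      using P1 sum_inverse_multiples_le[of _ ?n] unfolding B_def
      by (intro sum_mono mult_left_mono) (auto simp: Suc_le_eq)
    also have "\<dots> = fact ?n * harm ?n * (\<Sum>p\<in>P. 1 / real p ^ 2)"
      by (simp add: sum_distrib_left power2_eq_square)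
    also have "\<dots> \<le> fact ?n * harm ?n * (\<Sum>p\<in>{N<..?n}. 1 / real p ^ 2)"
      using assms(3) by (intro mult_left_mono sum_mono2) (auto intro!: mult_nonneg_nonneg harm_nonneg)
    also have "\<dots> \<le> fact ?n * harm ?n * (1 / real N)"
      using sum_inverse_squares_le[OF assms(2)]
      by (intro mult_left_mono) (auto intro!: mult_nonneg_nonneg harm_nonneg)
    finally show ?thesis by simp
  qed
  have fin: "finite {\<sigma>. \<sigma> permutes S}" using assms(1) by (simp add: finite_permutations)
  have "real (card {\<sigma>. \<sigma> permutes S \<and> \<not> prime_cycle_power \<sigma>})
      = (\<Sum>\<sigma> | \<sigma> permutes S \<and> \<not> prime_cycle_power \<sigma>. 1)" by simp
  also have "\<dots> \<le> (\<Sum>\<sigma> | \<sigma> permutes S \<and> \<not> prime_cycle_power \<sigma>. ((X \<sigma> - \<mu>) / \<mu>)\<^sup>2 + Y \<sigma>)"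
    using key by (intro sum_mono) auto
  also have "\<dots> \<le> (\<Sum>\<sigma> | \<sigma> permutes S. ((X \<sigma> - \<mu>) / \<mu>)\<^sup>2 + Y \<sigma>)"
    using fin Ynn by (intro sum_mono2) auto
  also have "\<dots> = (\<Sum>\<sigma> | \<sigma> permutes S. (X \<sigma> - \<mu>)\<^sup>2) / \<mu>\<^sup>2 + (\<Sum>\<sigma> | \<sigma> permutes S. Y \<sigma>)"
    by (simp add: sum.distrib power_divide sum_divide_distrib)
  also have "\<dots> \<le> (fact ?n * \<mu>) / \<mu>\<^sup>2 + fact ?n * (harm ?n / real N)"
    using sum_square_deviation_le[OF assms(1) finP P1] EY
    unfolding X_def \<mu>_def[symmetric] by (intro add_mono divide_right_mono) auto
  also have "\<dots> = fact ?n * (1 / \<mu> + harm ?n / real N)"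
    using \<open>\<mu> > 0\<close> by (simp add: power2_eq_square algebra_simps)
  finally show ?thesis .
qed

section \<open>Choice of the cutoff and passage to the limit\<close>

lemma eventually_card_not_prime_cycle_power_le:
  "eventually (\<lambda>n. real (card {\<sigma>. \<sigma> permutes {1..n} \<and> \<not> prime_cycle_power \<sigma>}) / fact n
     \<le> 1 / (ln (ln (real n)) / 4 - 2) + (1 + ln (real n)) / (ln (real n) powr (3/2) - 1)) at_top"
proof -
  have "eventually (\<lambda>n::nat. ln (ln (real n)) / 4 - 2 > 0) at_top" by real_asymp
  moreover have "eventually (\<lambda>n::nat. ln (real n) > 1) at_top" by real_asymp
  moreover have "eventually (\<lambda>n::nat. ln (real n) powr (3/2) > 2) at_top" by real_asymp
  moreover have "eventually (\<lambda>n::nat. n \<ge> 2) at_top" by (rule eventually_ge_at_top)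
  ultimately show ?thesis
  proof eventually_elim
    case (elim n)
    \<comment> \<open>An exponent above \<open>1\<close> makes \<open>harm n / N\<close> vanish; one
      below \<open>2\<close> keeps half of \<open>ln L\<close> smaller than \<open>ln (ln n)\<close>
      by a positive proportion.\<close>
    define L where "L = ln (real n) powr (3/2)"
    define N where "N = nat \<lfloor>L\<rfloor>"
    have L2: "L > 2" using elim by (simp add: L_def)
    have NL: "real N \<le> L" "real N \<ge> L - 1" using L2 unfolding N_def by linarith+
    have N1: "N \<ge> 1" using NL L2 by linarith
    define P where "P = {p. prime p \<and> N < p \<and> p \<le> n}"
    define \<mu> where "\<mu> = (\<Sum>p\<in>P. 1 / real p)"
    have "(\<Sum>p | prime p \<and> p \<le> n. 1 / real p) \<le> (\<Sum>p\<in>P \<union> {p. prime p \<and> p \<le> N}. 1 / real p)"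
      by (intro sum_mono2) (auto simp: P_def)
    also have "\<dots> = \<mu> + (\<Sum>p | prime p \<and> p \<le> N. 1 / real p)"
      unfolding \<mu>_def by (intro sum.union_disjoint) (auto simp: P_def)
    finally have "ln (ln (real n)) - ln 2 \<le> \<mu> + (\<Sum>p | prime p \<and> p \<le> N. 1 / real p)"
      using sum_inverse_primes_ge[of n] elim by linarith
    moreover have "(\<Sum>p | prime p \<and> p \<le> N. 1 / real p) \<le> 1 / 2 + harm N / 2"
      by (rule sum_inverse_primes_le)
    moreover have "harm N \<le> 1 + ln (real N)" by (rule harm_le_ln[OF N1])
    moreover have "ln (real N) \<le> ln L" using NL N1 by (intro ln_mono) auto
    moreover have "ln L = 3 / 2 * ln (ln (real n))" using elim by (simp add: L_def ln_powr)
    moreover have "ln 2 \<le> (1::real)" using ln_2_less_1 by simp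
    \<comment> \<open>The coefficient is \<open>1 - 3/4\<close>; the constants lost are
      \<open>ln 2\<close>, at most \<open>1\<close>, and twice \<open>1 / 2\<close>.\<close>
    ultimately have \<mu>: "\<mu> \<ge> ln (ln (real n)) / 4 - 2" by argo
    then have \<mu>0: "\<mu> > 0" using elim by linarith
    have "real (card {\<sigma>. \<sigma> permutes {1..n} \<and> \<not> prime_cycle_power \<sigma>}) / fact n
        \<le> 1 / \<mu> + harm n / real N"
      using card_not_prime_cycle_power_le[of "{1..n}" N P \<mu>] N1 \<mu>0 P_def \<mu>_def
      by (simp add: divide_le_eq mult.commute)
    also have "\<dots> \<le> 1 / (ln (ln (real n)) / 4 - 2) + (1 + ln (real n)) / (L - 1)"
      using \<mu> \<mu>0 elim harm_le_ln[of n] NL L2 N1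
      by (intro add_mono frac_le) auto
    finally show ?case unfolding L_def .
  qed
qed

lemma perm_proportion_compl:
  "perm_proportion n P = 1 - real (card {\<sigma>. \<sigma> permutes {1..n} \<and> \<not> P \<sigma>}) / fact n"
proof -
  let ?G = "{\<sigma>. \<sigma> permutes {1..n} \<and> P \<sigma>}" and ?B = "{\<sigma>. \<sigma> permutes {1..n} \<and> \<not> P \<sigma>}"
  have fin: "finite {\<sigma>. \<sigma> permutes {1..n}}" by (simp add: finite_permutations)
  have "card ?G + card ?B = card (?G \<union> ?B)"
    by (rule card_Un_disjoint[symmetric]; (rule finite_subset[OF _ fin])?) auto
  also have "?G \<union> ?B = {\<sigma>. \<sigma> permutes {1..n}}" by auto
  also have "card \<dots> = fact n" by (simp add: card_permutations)
  finally have "real (card ?G + card ?B) = real (fact n)"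
    by (rule arg_cong)
  then have "real (card ?G) = fact n - real (card ?B)"
    unfolding of_nat_add of_nat_fact by linarith
  then show ?thesis
    unfolding perm_proportion_def sym_group_carrier by (simp add: diff_divide_distrib)
qed

lemma perm_proportion_le_1: "perm_proportion n P \<le> 1"
  unfolding perm_proportion_compl by simp

lemma perm_proportion_mono:
  assumes "\<And>\<sigma>. P \<sigma> \<Longrightarrow> Q \<sigma>"
  shows "perm_proportion n P \<le> perm_proportion n Q"
proof -
  have "finite (carrier (sym_group n))" by (simp add: sym_group_def finite_permutations)
  then have "card {\<sigma> \<in> carrier (sym_group n). P \<sigma>} \<le> card {\<sigma> \<in> carrier (sym_group n). Q \<sigma>}"
    using assms by (intro card_mono) auto
  then show ?thesis unfolding perm_proportion_def by (intro divide_right_mono) auto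
qed

theorem theorem2:
  shows "(\<lambda>n. perm_proportion n
            (\<lambda>\<sigma>. \<exists>(m::int) (p::nat). prime p \<and>
                   is_cycle_of_length p (\<sigma> [^]\<^bsub>sym_group n\<^esub> m)))
         \<longlonglongrightarrow> 1"
    (is "(\<lambda>n. perm_proportion n (?good n)) \<longlonglongrightarrow> 1")
proof -
  let ?bad = "\<lambda>n. real (card {\<sigma>. \<sigma> permutes {1..n} \<and> \<not> prime_cycle_power \<sigma>}) / fact n"
  let ?bound = "\<lambda>n. 1 / (ln (ln (real n)) / 4 - 2) + (1 + ln (real n)) / (ln (real n) powr (3/2) - 1)"
  have lower: "1 - ?bound n \<le> perm_proportion n (?good n)" if "?bad n \<le> ?bound n" for n
  proof -
    have "1 - ?bound n \<le> 1 - ?bad n" using that by (rule diff_left_mono)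
    also have "\<dots> = perm_proportion n prime_cycle_power" by (rule perm_proportion_compl[symmetric])
    also have "\<dots> \<le> perm_proportion n (?good n)"
      by (rule perm_proportion_mono) (metis prime_cycle_power_def sym_group_int_pow)
    finally show ?thesis .
  qed
  have ev: "eventually (\<lambda>n. 1 - ?bound n \<le> perm_proportion n (?good n)) at_top"
    by (rule eventually_mono[OF eventually_card_not_prime_cycle_power_le lower])
  \<comment> \<open>Both terms of the bound vanish: \<open>ln (ln n)\<close> is unbounded, and
    \<open>ln n\<close> is of smaller order than \<open>ln n powr (3/2)\<close>.\<close>
  have lim: "(\<lambda>n. 1 - ?bound n) \<longlonglongrightarrow> 1" by real_asymp
  show ?thesis
    by (rule tendsto_sandwich[OF ev always_eventually lim tendsto_const])
       (rule allI, rule perm_proportion_le_1)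
qed

end
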